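(* Let $n\ge1$, $k\ge 1$, and let $(K_1,d_{K_1}),\dots,(K_n,d_{K_n})$ be finite metric spaces of diameter at most $1$, each of cardinality at most $k$. Let $\delta>0$. Then any probability measure $\mu$ on $\prod_{i=1}^n K_i$ may be written as a mixture $$\mu=p_1\mu_1+\cdots+p_m\mu_m$$ (with $(p_1,\dots,p_m)$ a probability vector and each $\mu_j$ a probability measure on $\prod_i K_i$) in which (a) $m\le k^{\mathrm{DTC}(\mu)/\delta^2}$, and (b) there are product measures $\xi_j$ on $\prod_i K_i$, $j=1,2,\dots,m$, such that $$\sum_{j=1}^m p_j\cdot\overline{d_n}(\mu_j,\xi_j)<\delta.$$
   Context: Logarithms are natural. $\mathrm{H}$ denotes Shannon entropy. For finite-valued random variables, the dual total correlation is $\mathrm{DTC}(X_1;\dots;X_n)=\mathrm{H}(X_1,\dots,X_n)-\sum_{i=1}^n\mathrm{H}(X_i\,|\,(X_j)_{j\ne i})$, and $\mathrm{DTC}(\mu)$ is this quantity for random variables $(X_1,\dots,X_n)$ with joint distribution $\mu$. Metrics: $d_n(x,y):=\frac1n\sum_{i=1}^n d_{K_i}(x_i,y_i)$ on $\prod_i K_i$, and $\overline{d_n}(\mu,\nu):=\inf_\lambda\int d_n(x,y)\,\lambda(\mathrm{d}x,\mathrm{d}y)$, where $\lambda$ ranges over all couplings of the probability measures $\mu,\nu$ on $\prod_i K_i$. A product measure on $\prod_i K_i$ is one of the form $\eta_1\times\cdots\times\eta_n$ with each $\eta_i$ a probability measure on $K_i$. *)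

theory Defs
  imports "HOL-Probability.Probability"
begin

text \<open>
  Finite-valued random variables are given by an index set \<open>I\<close> and a family \<open>X\<close> on a
  probability space. The tuple \<open>(X\<^sub>j)\<^sub>j\<^sub>\<in>\<^sub>J\<close> is the random variable with extensional values
  \<open>\<lambda>\<omega>. \<lambda>j\<in>J. X j \<omega>\<close>. Every entropy is taken with respect to counting measure on the
  (finite) range, as in the notations \<open>\<H>(X)\<close> and \<open>\<H>(X | Y)\<close> of
  \<^locale>\<open>information_space\<close>, and to the base \<open>exp 1\<close>, since logarithms are natural.
\<close>

definition (in prob_space) dual_total_correlation :: "'i set \<Rightarrow> ('i \<Rightarrow> 'a \<Rightarrow> 'b) \<Rightarrow> real"
  where "dual_total_correlation I X =
    (let tuple = (\<lambda>J \<omega>. \<lambda>j\<in>J. X j \<omega>)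
     in entropy (exp 1) (count_space (tuple I ` space M)) (tuple I)
        - (\<Sum>i\<in>I. conditional_entropy (exp 1)
             (count_space (X i ` space M)) (count_space (tuple (I - {i}) ` space M))
             (X i) (tuple (I - {i}))))"

definition DTC :: "'i set \<Rightarrow> ('i \<Rightarrow> 'a) measure \<Rightarrow> real"
  where "DTC I \<mu> = prob_space.dual_total_correlation \<mu> I (\<lambda>i \<omega>. \<omega> i)"

abbreviation prod_space :: "nat \<Rightarrow> (nat \<Rightarrow> 'a set) \<Rightarrow> (nat \<Rightarrow> 'a) measure"
  where "prod_space n K \<equiv> (\<Pi>\<^sub>M i\<in>{1..n}. count_space (K i))"

text \<open>
  \<open>space (prob_algebra N)\<close> is the set of all probability measures on the measurable space \<open>N\<close>.
\<close>

definition product_measures :: "nat \<Rightarrow> (nat \<Rightarrow> 'a set) \<Rightarrow> (nat \<Rightarrow> 'a) measure set"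
  where "product_measures n K =
    {(\<Pi>\<^sub>M i\<in>{1..n}. \<eta> i) | \<eta>. \<forall>i\<in>{1..n}. \<eta> i \<in> space (prob_algebra (count_space (K i)))}"

definition mean_dist ::
    "nat \<Rightarrow> (nat \<Rightarrow> 'a \<Rightarrow> 'a \<Rightarrow> real) \<Rightarrow> (nat \<Rightarrow> 'a) \<Rightarrow> (nat \<Rightarrow> 'a) \<Rightarrow> real"
  where "mean_dist n d x y = 1 / real n * (\<Sum>i=1..n. d i (x i) (y i))"

definition couplings :: "'a measure \<Rightarrow> 'b measure \<Rightarrow> ('a \<times> 'b) measure set"
  where "couplings \<mu> \<nu> =
    {\<gamma> \<in> space (prob_algebra (\<mu> \<Otimes>\<^sub>M \<nu>)). distr \<gamma> \<mu> fst = \<mu> \<and> distr \<gamma> \<nu> snd = \<nu>}"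

definition transport_dist :: "('a \<Rightarrow> 'a \<Rightarrow> real) \<Rightarrow> 'a measure \<Rightarrow> 'a measure \<Rightarrow> real"
  where "transport_dist c \<mu> \<nu> = (INF \<gamma> \<in> couplings \<mu> \<nu>. \<integral>z. c (fst z) (snd z) \<partial>\<gamma>)"

end

theory Submission
  imports Defs
begin

text \<open>
  Write \<open>X\<close> for a random point with law \<open>\<mu>\<close>, and \<open>X\<^sub>J\<close> for its coordinates in \<open>J\<close>. The mixture
  is the disintegration of \<open>\<mu>\<close> over the values of \<open>X\<^sub>S\<close>, for a well-chosen set \<open>S\<close> of coordinates;
  it has at most \<open>k\<close> to the power \<open>card S\<close> terms, so (a) holds as soon as
  \<open>\<delta>\<^sup>2 * card S \<le> DTC(\<mu>)\<close>.

  The set \<open>S\<close> comes from an exact accounting identity. If \<open>DTC(X | X\<^sub>S)\<close> is the dual total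
  correlation of the remaining coordinates conditionally on \<open>X\<^sub>S\<close>, then adding a coordinate \<open>i\<close> to
  \<open>S\<close> lowers it by exactly the mutual information, given \<open>X\<^sub>S\<close>, of \<open>X\<^sub>i\<close> and all the other coordinates.
  It starts at \<open>DTC(\<mu>)\<close> and stays nonnegative, so one can condition on coordinates whose mutual information
  with the rest is at least \<open>\<delta>\<^sup>2\<close> no more than \<open>DTC(\<mu>) / \<delta>\<^sup>2\<close> times. When no such
  coordinate is left, every \<open>i\<close> satisfies \<open>I(X\<^sub>i ; X\<^sub>1, ..., X\<^sub>i\<^sub>-\<^sub>1 | X\<^sub>S) < \<delta>\<^sup>2\<close>
  (lemma \<open>exists_conditioning_set_small_dependence\<close>).

  For (b), each term of the mixture is compared with the product of its own marginals. Reading the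
  coordinates one after the other, one couples the law of \<open>X\<^sub>i\<close> given the past optimally with its
  marginal law. The second marginal of the resulting coupling is a product measure, and the \<open>i\<close>-th
  coordinates differ with probability at most the total variation distance between the joint law of
  \<open>(X\<^sub>i, past)\<close> and the product of its marginals (lemma \<open>sequential_coupling\<close>). The square of that
  distance is at most the mutual information, by an inequality of Pinsker type. Hence the mean
  distance in (b), averaged over \<open>i\<close>, is below \<open>\<delta>\<close>. The constant in the inequality
  matters: with \<open>TV\<^sup>2 \<le> KL\<close> the strict bound \<open>\<delta>\<^sup>2\<close> on the informations gives exactly
  the strict bound \<open>\<delta>\<close>.

  All this is carried out for probability mass functions of finite support, where kernels and
  couplings are monadic expressions; the measures of the theorem are identified with such mass
  functions only in the last two sections.
\<close>

section \<open>Total variation, relative entropy and mutual information\<close>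

text \<open>
  A form of Pinsker's inequality whose proof passes through the Hellinger distance
  \<open>H\<^sup>2 = \<Sum> (sqrt P - sqrt Q)\<^sup>2\<close>. Factoring \<open>P - Q\<close> as a difference of two squares and
  applying Cauchy-Schwarz gives \<open>TV \<le> H\<close>, and \<open>ln t \<le> t - 1\<close> at \<open>t = sqrt (Q / P)\<close> gives
  \<open>H\<^sup>2 \<le> KL\<close>. The positive parts on the left add up to the total variation distance, since
  \<open>P\<close> and \<open>Q\<close> have the same mass.
\<close>

lemma pinsker_weak_finite:
  fixes P Q :: "'a \<Rightarrow> real"
  assumes "finite I"
    and P0: "\<And>i. i \<in> I \<Longrightarrow> 0 \<le> P i" and Q0: "\<And>i. i \<in> I \<Longrightarrow> 0 \<le> Q i"
    and ac: "\<And>i. i \<in> I \<Longrightarrow> Q i = 0 \<Longrightarrow> P i = 0"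
    and P1: "sum P I = 1" and Q1: "sum Q I = 1"
  shows "(\<Sum>i\<in>I. max 0 (P i - Q i))\<^sup>2 \<le> (\<Sum>i\<in>I. P i * (ln (P i) - ln (Q i)))"
proof -
  let ?u = "\<lambda>i. \<bar>sqrt (P i) - sqrt (Q i)\<bar>" and ?v = "\<lambda>i. sqrt (P i) + sqrt (Q i)"
  have "(\<Sum>i\<in>I. max 0 (P i - Q i)) = (\<Sum>i\<in>I. (\<bar>P i - Q i\<bar> + (P i - Q i)) / 2)"
    by (intro sum.cong refl) (simp add: max_def abs_if)
  also have "\<dots> = (\<Sum>i\<in>I. \<bar>P i - Q i\<bar>) / 2"
    by (simp add: sum.distrib sum_subtractf P1 Q1 flip: sum_divide_distrib)
  also have "(\<Sum>i\<in>I. \<bar>P i - Q i\<bar>) = (\<Sum>i\<in>I. ?u i * ?v i)"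
  proof (intro sum.cong refl)
    fix i assume "i \<in> I"
    then have "P i - Q i = (sqrt (P i) - sqrt (Q i)) * ?v i"
      using P0 Q0 by (simp add: algebra_simps)
    then show "\<bar>P i - Q i\<bar> = ?u i * ?v i"
      using P0[OF \<open>i \<in> I\<close>] Q0[OF \<open>i \<in> I\<close>] by (simp add: abs_mult)
  qed
  finally have "(\<Sum>i\<in>I. max 0 (P i - Q i))\<^sup>2 = (\<Sum>i\<in>I. ?u i * ?v i)\<^sup>2 / 4"
    by (simp only: power_divide) simp
  also have "\<dots> \<le> (\<Sum>i\<in>I. (?u i)\<^sup>2) * (\<Sum>i\<in>I. (?v i)\<^sup>2) / 4"
    using Cauchy_Schwarz_ineq_sum[of ?u ?v I] by simp
  also have "\<dots> \<le> (\<Sum>i\<in>I. (?u i)\<^sup>2) * 4 / 4"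
  proof (intro divide_right_mono mult_left_mono sum_nonneg)
    have "(\<Sum>i\<in>I. (?v i)\<^sup>2) \<le> (\<Sum>i\<in>I. 2 * P i + 2 * Q i)"
    proof (intro sum_mono)
      fix i assume "i \<in> I"
      have "(?v i)\<^sup>2 + (sqrt (P i) - sqrt (Q i))\<^sup>2 = 2 * P i + 2 * Q i"
        using P0[OF \<open>i \<in> I\<close>] Q0[OF \<open>i \<in> I\<close>] by (simp add: power2_sum power2_diff)
      then show "(?v i)\<^sup>2 \<le> 2 * P i + 2 * Q i"
        by (smt (verit) zero_le_power2)
    qed
    also have "\<dots> = 4"
      by (simp add: sum.distrib P1 Q1 flip: sum_distrib_left)
    finally show "(\<Sum>i\<in>I. (?v i)\<^sup>2) \<le> 4" .
  qed auto
  \<comment> \<open>The zero sum \<open>\<Sum> (Q - P)\<close> is split off to make a termwise comparison with \<open>KL\<close> possible.\<close>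
  also have "\<dots> = (\<Sum>i\<in>I. 2 * P i - 2 * sqrt (P i) * sqrt (Q i)) + (\<Sum>i\<in>I. Q i - P i)"
    unfolding sum.distrib[symmetric] using P0 Q0 by (auto simp: power2_diff intro!: sum.cong)
  also have "(\<Sum>i\<in>I. Q i - P i) = 0"
    by (simp add: sum_subtractf P1 Q1)
  also have "(\<Sum>i\<in>I. 2 * P i - 2 * sqrt (P i) * sqrt (Q i)) + 0
      \<le> (\<Sum>i\<in>I. P i * (ln (P i) - ln (Q i)))"
    unfolding add_0_right
  proof (intro sum_mono)
    fix i assume i: "i \<in> I"
    show "2 * P i - 2 * sqrt (P i) * sqrt (Q i) \<le> P i * (ln (P i) - ln (Q i))"
    proof (cases "P i = 0")
      case False
      then have pos: "P i > 0" "Q i > 0"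
        using P0[OF i] Q0[OF i] ac[OF i] by (auto simp: less_le)
      let ?r = "sqrt (Q i) / sqrt (P i)"
      have "ln (Q i) - ln (P i) = 2 * ln ?r"
        using pos by (simp add: ln_div ln_sqrt)
      also have "\<dots> \<le> 2 * (?r - 1)"
        using ln_le_minus_one[of ?r] pos by simp
      finally have "P i * (2 * (1 - ?r)) \<le> P i * (ln (P i) - ln (Q i))"
        using pos by (intro mult_left_mono) auto
      moreover have "P i * (2 * (1 - ?r)) = 2 * P i - 2 * sqrt (P i) * sqrt (Q i)"
      proof -
        have "P i * ?r = sqrt (P i) * sqrt (P i) * ?r"
          using pos by simp
        also have "\<dots> = sqrt (P i) * sqrt (Q i)"
          using pos by (simp del: real_sqrt_mult_self)
        finally have "P i * ?r = sqrt (P i) * sqrt (Q i)" .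
        moreover have "P i * (2 * (1 - ?r)) = 2 * P i - 2 * (P i * ?r)"
          by (simp only: right_diff_distrib mult_1_right mult.left_commute)
        ultimately show ?thesis by simp
      qed
      ultimately show ?thesis by simp
    qed simp
  qed
  finally show ?thesis .
qed

text \<open>
  Shannon entropy as an expectation rather than a sum: then the entropy of \<open>map_pmf f p\<close> is an
  expectation under \<open>p\<close> itself, and entropies of several images of \<open>p\<close> can be compared pointwise.
\<close>

definition pmf_entropy :: "'a pmf \<Rightarrow> real"
  where "pmf_entropy q = measure_pmf.expectation q (\<lambda>a. - ln (pmf q a))"

text \<open>
  The total variation distance between a joint law and the product of its marginals. Points outside
  the support of the joint law contribute nothing to the positive part.
\<close>

definition dependence :: "('a \<times> 'b) pmf \<Rightarrow> real"
  where "dependence r = (\<Sum>z\<in>set_pmf r.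
    max 0 (pmf r z - pmf (map_pmf fst r) (fst z) * pmf (map_pmf snd r) (snd z)))"

lemma expectation_finite_pmf:
  fixes g :: "'a \<Rightarrow> real"
  assumes "finite (set_pmf p)"
  shows "measure_pmf.expectation p g = (\<Sum>x\<in>set_pmf p. pmf p x * g x)"
  using integral_measure_pmf[OF assms, of p g] by simp

lemma dependence_eq_sum_product:
  assumes "finite A" "finite B" "set_pmf r \<subseteq> A \<times> B"
  shows "dependence r =
    (\<Sum>(a, b)\<in>A \<times> B. max 0 (pmf r (a, b) - pmf (map_pmf fst r) a * pmf (map_pmf snd r) b))"
  unfolding dependence_def
  by (rule sum.mono_neutral_cong_left) (use assms in \<open>auto simp: set_pmf_iff\<close>)

lemma pmf_entropy_map:
  "pmf_entropy (map_pmf f p) = measure_pmf.expectation p (\<lambda>w. - ln (pmf (map_pmf f p) (f w)))"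
  unfolding pmf_entropy_def by simp

text \<open>
  The right-hand side is the mutual information, that is, the relative entropy of the joint law with
  respect to the product of its marginals.
\<close>

lemma dependence_square_le_mutual_information:
  fixes r :: "('a \<times> 'b) pmf"
  assumes "finite (set_pmf r)"
  shows "(dependence r)\<^sup>2 \<le>
    pmf_entropy (map_pmf fst r) + pmf_entropy (map_pmf snd r) - pmf_entropy r"
proof -
  let ?P = "pmf (map_pmf fst r)" and ?Q = "pmf (map_pmf snd r)"
  let ?A = "set_pmf (map_pmf fst r)" and ?B = "set_pmf (map_pmf snd r)"
  have fin: "finite ?A" "finite ?B" using assms by auto
  have sub: "set_pmf r \<subseteq> ?A \<times> ?B" by force
  have "(dependence r)\<^sup>2 = (\<Sum>z\<in>?A \<times> ?B. max 0 (pmf r z - ?P (fst z) * ?Q (snd z)))\<^sup>2"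
    by (subst dependence_eq_sum_product[OF fin sub]) (simp add: case_prod_beta)
  also have "\<dots> \<le> (\<Sum>z\<in>?A \<times> ?B. pmf r z * (ln (pmf r z) - ln (?P (fst z) * ?Q (snd z))))"
  proof (rule pinsker_weak_finite)
    fix z assume "z \<in> ?A \<times> ?B" "?P (fst z) * ?Q (snd z) = 0"
    then have False by (auto simp del: set_map_pmf simp: set_pmf_iff)
    then show "pmf r z = 0" ..
  next
    show "sum (pmf r) (?A \<times> ?B) = 1"
      using sub fin by (intro sum_pmf_eq_1) auto
    have "(\<Sum>z\<in>?A \<times> ?B. ?P (fst z) * ?Q (snd z)) = sum ?P ?A * sum ?Q ?B"
      unfolding sum_product sum.cartesian_product by (simp add: case_prod_beta)
    then show "(\<Sum>z\<in>?A \<times> ?B. ?P (fst z) * ?Q (snd z)) = 1"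
      by (simp only: sum_pmf_eq_1[OF fin(1) order.refl] sum_pmf_eq_1[OF fin(2) order.refl] mult_1)
  qed (use fin in auto)
  also have "\<dots> = (\<Sum>z\<in>set_pmf r. pmf r z * (ln (pmf r z) - ln (?P (fst z)) - ln (?Q (snd z))))"
  proof (rule sum.mono_neutral_cong_right)
    fix z assume "z \<in> set_pmf r"
    then have "?P (fst z) \<noteq> 0" "?Q (snd z) \<noteq> 0"
      by (auto simp flip: set_pmf_iff)
    then show "pmf r z * (ln (pmf r z) - ln (?P (fst z) * ?Q (snd z)))
        = pmf r z * (ln (pmf r z) - ln (?P (fst z)) - ln (?Q (snd z)))"
      by (simp add: ln_mult)
  qed (use fin sub in \<open>auto simp: set_pmf_iff\<close>)
  also have "\<dots> = pmf_entropy (map_pmf fst r) + pmf_entropy (map_pmf snd r) - pmf_entropy r"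
    unfolding pmf_entropy_map pmf_entropy_def
    by (simp add: expectation_finite_pmf[OF assms] sum.distrib sum_subtractf sum_negf algebra_simps)
  finally show ?thesis .
qed

text \<open>
  Conditioning on a null event gives an unspecified mass function, so facts about the fibre over
  \<open>z\<close> are stated for \<open>z\<close> in the image of the support.
\<close>

definition fibre_pmf :: "'w pmf \<Rightarrow> ('w \<Rightarrow> 'c) \<Rightarrow> 'c \<Rightarrow> 'w pmf"
  where "fibre_pmf p f z = cond_pmf p {w. f w = z}"

lemma fibre_nonempty: "z \<in> f ` set_pmf p \<Longrightarrow> set_pmf p \<inter> {w. f w = z} \<noteq> {}"
  by auto

lemma set_fibre_pmf: "z \<in> f ` set_pmf p \<Longrightarrow> set_pmf (fibre_pmf p f z) = set_pmf p \<inter> {w. f w = z}"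
  unfolding fibre_pmf_def by (rule set_cond_pmf[OF fibre_nonempty])

text \<open>
  Disintegration: this identity is what makes the conditional laws the terms of a mixture, with the
  law of \<open>f\<close> as weights.
\<close>

lemma bind_fibre_pmf: "bind_pmf (map_pmf f p) (fibre_pmf p f) = p"
  unfolding fibre_pmf_def
proof (rule bind_cond_pmf_cancel[where R = "\<lambda>z w. f w = z"])
  fix z assume "z \<in> set_pmf (map_pmf f p)"
  then show "set_pmf p \<inter> {w. f w = z} \<noteq> {}" by auto
next
  fix w assume "w \<in> set_pmf p"
  then show "set_pmf (map_pmf f p) \<inter> {z. f w = z} \<noteq> {}" by auto
next
  fix z w assume "f w = z"
  then show "measure_pmf.prob p {w. f w = z} = measure_pmf.prob (map_pmf f p) {z. f w = z}"
    by (simp add: vimage_def eq_commute)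
qed

lemma pmf_fibre_joint:
  assumes "z \<in> f ` set_pmf p"
  shows "pmf (map_pmf (\<lambda>w. (g w, f w)) p) (v, z)
    = pmf (map_pmf f p) z * pmf (map_pmf g (fibre_pmf p f z)) v"
proof -
  note ne = fibre_nonempty[OF assms]
  have pos: "measure_pmf.prob p {w. f w = z} \<noteq> 0"
    using ne by (auto simp: measure_pmf_zero_iff)
  have "pmf (map_pmf g (fibre_pmf p f z)) v
      = measure_pmf.prob p ({w. f w = z} \<inter> g -` {v}) / measure_pmf.prob p {w. f w = z}"
    unfolding fibre_pmf_def pmf_map cond_pmf.rep_eq[OF ne]
    using pos by (subst measure_uniform_measure) (auto simp: measure_pmf.emeasure_eq_measure)
  moreover have "(\<lambda>w. (g w, f w)) -` {(v, z)} = {w. f w = z} \<inter> g -` {v}" by auto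
  moreover have "f -` {z} = {w. f w = z}" by auto
  ultimately show ?thesis using pos by (simp add: pmf_map)
qed

text \<open>
  On the fibre over \<open>z\<close> the joint probability of \<open>(g, f)\<close> is the probability of \<open>z\<close> times a
  conditional one, so its logarithm splits; averaging over the fibres gives both sides. The left-hand
  side is the conditional entropy of \<open>g\<close> given \<open>f\<close>.
\<close>

lemma pmf_entropy_chain_rule:
  assumes fin: "finite (set_pmf p)"
  shows "(\<Sum>z\<in>f ` set_pmf p. pmf (map_pmf f p) z * pmf_entropy (map_pmf g (fibre_pmf p f z)))
    = pmf_entropy (map_pmf (\<lambda>w. (g w, f w)) p) - pmf_entropy (map_pmf f p)"
proof -
  let ?r = "map_pmf (\<lambda>w. (g w, f w)) p"
  let ?F = "\<lambda>w. ln (pmf (map_pmf f p) (f w)) - ln (pmf ?r (g w, f w))"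
  have "pmf_entropy ?r - pmf_entropy (map_pmf f p) = measure_pmf.expectation p ?F"
    unfolding pmf_entropy_map expectation_finite_pmf[OF fin]
    by (simp add: sum_subtractf[symmetric] algebra_simps flip: sum_negf)
  also have "\<dots> = measure_pmf.expectation (bind_pmf (map_pmf f p) (fibre_pmf p f)) ?F"
    by (simp only: bind_fibre_pmf)
  also have "\<dots> = (\<Sum>z\<in>f ` set_pmf p. pmf (map_pmf f p) z *\<^sub>R measure_pmf.expectation (fibre_pmf p f z) ?F)"
    using fin by (intro pmf_expectation_bind) (auto simp: set_fibre_pmf)
  also have "\<dots> = (\<Sum>z\<in>f ` set_pmf p. pmf (map_pmf f p) z * pmf_entropy (map_pmf g (fibre_pmf p f z)))"
  proof (intro sum.cong refl)
    fix z assume z: "z \<in> f ` set_pmf p"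
    have "measure_pmf.expectation (fibre_pmf p f z) ?F = pmf_entropy (map_pmf g (fibre_pmf p f z))"
      unfolding pmf_entropy_map
    proof (intro integral_cong_AE AE_pmfI)
      fix w assume w: "w \<in> set_pmf (fibre_pmf p f z)"
      then have fw: "f w = z" using set_fibre_pmf[OF z] by auto
      have "pmf (map_pmf g (fibre_pmf p f z)) (g w) \<noteq> 0" using w by (auto simp flip: set_pmf_iff)
      moreover have "pmf (map_pmf f p) z \<noteq> 0" using z by (auto simp flip: set_pmf_iff)
      ultimately show "?F w = - ln (pmf (map_pmf g (fibre_pmf p f z)) (g w))"
        unfolding fw pmf_fibre_joint[OF z] by (simp add: ln_mult)
    qed auto
    then show "pmf (map_pmf f p) z *\<^sub>R measure_pmf.expectation (fibre_pmf p f z) ?F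
        = pmf (map_pmf f p) z * pmf_entropy (map_pmf g (fibre_pmf p f z))" by simp
  qed
  finally show ?thesis by simp
qed

text \<open>
  The right-hand side is the conditional mutual information of \<open>f\<close> and \<open>g\<close> given \<open>h\<close>. The
  Pinsker-type bound holds on each fibre of \<open>h\<close>, and convexity of the square allows it to be
  averaged. Since squares are nonnegative, this also yields submodularity of entropy below.
\<close>

lemma mean_dependence_square_le:
  assumes fin: "finite (set_pmf p)"
  shows "(\<Sum>z\<in>h ` set_pmf p. pmf (map_pmf h p) z *
            dependence (map_pmf (\<lambda>w. (f w, g w)) (fibre_pmf p h z)))\<^sup>2
    \<le> pmf_entropy (map_pmf (\<lambda>w. (f w, h w)) p) + pmf_entropy (map_pmf (\<lambda>w. (g w, h w)) p)
      - pmf_entropy (map_pmf (\<lambda>w. ((f w, g w), h w)) p) - pmf_entropy (map_pmf h p)"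
proof -
  let ?Z = "h ` set_pmf p" and ?\<pi> = "pmf (map_pmf h p)"
  let ?t = "\<lambda>z. dependence (map_pmf (\<lambda>w. (f w, g w)) (fibre_pmf p h z))"
  have "(\<Sum>z\<in>?Z. ?\<pi> z * ?t z)\<^sup>2 = (\<Sum>z\<in>?Z. sqrt (?\<pi> z) * (sqrt (?\<pi> z) * ?t z))\<^sup>2"
    by (simp flip: mult.assoc)
  also have "\<dots> \<le> (\<Sum>z\<in>?Z. (sqrt (?\<pi> z))\<^sup>2) * (\<Sum>z\<in>?Z. (sqrt (?\<pi> z) * ?t z)\<^sup>2)"
    by (rule Cauchy_Schwarz_ineq_sum)
  also have "(\<Sum>z\<in>?Z. (sqrt (?\<pi> z))\<^sup>2) = 1"
    using fin by (simp add: sum_pmf_eq_1)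
  also have "1 * (\<Sum>z\<in>?Z. (sqrt (?\<pi> z) * ?t z)\<^sup>2) = (\<Sum>z\<in>?Z. ?\<pi> z * (?t z)\<^sup>2)"
    by (simp add: power_mult_distrib)
  also have "\<dots> \<le> (\<Sum>z\<in>?Z. ?\<pi> z * (pmf_entropy (map_pmf f (fibre_pmf p h z))
      + pmf_entropy (map_pmf g (fibre_pmf p h z))
      - pmf_entropy (map_pmf (\<lambda>w. (f w, g w)) (fibre_pmf p h z))))"
  proof (intro sum_mono mult_left_mono)
    fix z assume z: "z \<in> ?Z"
    show "(?t z)\<^sup>2 \<le> pmf_entropy (map_pmf f (fibre_pmf p h z))
      + pmf_entropy (map_pmf g (fibre_pmf p h z))
      - pmf_entropy (map_pmf (\<lambda>w. (f w, g w)) (fibre_pmf p h z))"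
      using dependence_square_le_mutual_information[of "map_pmf (\<lambda>w. (f w, g w)) (fibre_pmf p h z)"]
        fin by (simp add: pmf.map_comp comp_def set_fibre_pmf[OF z])
  qed auto
  also have "\<dots> = pmf_entropy (map_pmf (\<lambda>w. (f w, h w)) p) + pmf_entropy (map_pmf (\<lambda>w. (g w, h w)) p)
      - pmf_entropy (map_pmf (\<lambda>w. ((f w, g w), h w)) p) - pmf_entropy (map_pmf h p)"
    using pmf_entropy_chain_rule[OF fin, where f = h and g = f]
      pmf_entropy_chain_rule[OF fin, where f = h and g = g]
      pmf_entropy_chain_rule[OF fin, where f = h and g = "\<lambda>w. (f w, g w)"]
    by (simp add: ring_distribs sum.distrib sum_subtractf)
  finally show ?thesis .
qed

section \<open>Couplings with a product of marginals\<close>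

lemma prob_bind_pmf_finite:
  assumes "finite A" "set_pmf p \<subseteq> A" "\<And>a. a \<in> A \<Longrightarrow> finite (set_pmf (f a))"
  shows "measure_pmf.prob (bind_pmf p f) X = (\<Sum>a\<in>A. pmf p a * measure_pmf.prob (f a) X)"
  using pmf_expectation_bind[OF assms(1,3,2), where h = "indicator X :: _ \<Rightarrow> real"] by simp

text \<open>
  The coupling keeps the common mass \<open>min P Q\<close> on the diagonal and couples the two remainders
  independently; both remainders have mass \<open>e\<close>, the total variation distance.
\<close>

lemma maximal_coupling:
  fixes P Q :: "'a pmf"
  assumes "finite (set_pmf P)" "finite (set_pmf Q)"
  obtains c where "map_pmf fst c = P" "map_pmf snd c = Q"
    "measure_pmf.prob c {z. fst z \<noteq> snd z} \<le> (\<Sum>a\<in>set_pmf P. max 0 (pmf P a - pmf Q a))"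
proof -
  define S where "S = set_pmf P \<union> set_pmf Q"
  define m where "m a = min (pmf P a) (pmf Q a)" for a
  define e where "e = 1 - sum m S"
  define f where "f = (\<lambda>(a, b). (if a = b then m a else 0) + (pmf P a - m a) * (pmf Q b - m b) / e)"
  have S: "finite S" using assms by (simp add: S_def)
  have outside: "pmf P a = 0" "pmf Q a = 0" "m a = 0" if "a \<notin> S" for a
    using that by (auto simp: S_def m_def set_pmf_iff)
  have m: "0 \<le> m a" "m a \<le> pmf P a" "m a \<le> pmf Q a" for a
    by (auto simp: m_def)
  have restP: "(\<Sum>a\<in>S. pmf P a - m a) = e"
    using S by (simp add: sum_subtractf e_def sum_pmf_eq_1 S_def)
  have restQ: "(\<Sum>a\<in>S. pmf Q a - m a) = e"
    using S by (simp add: sum_subtractf e_def sum_pmf_eq_1 S_def)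
  have e: "0 \<le> e"
    unfolding restP[symmetric] using m by (intro sum_nonneg) simp
  \<comment> \<open>If \<open>e = 0\<close> the formula divides by zero; the remainders it divides vanish then.\<close>
  have e0: "pmf P a - m a = 0" "pmf Q a - m a = 0" if "e = 0" for a
  proof -
    have "\<forall>a\<in>S. pmf P a - m a = 0" "\<forall>a\<in>S. pmf Q a - m a = 0"
      using restP restQ that m S
      by (subst sum_nonneg_eq_0_iff[symmetric]; simp)+
    then show "pmf P a - m a = 0" "pmf Q a - m a = 0"
      using outside[of a] by (cases "a \<in> S"; simp)+
  qed
  have rest_nonneg: "0 \<le> (pmf P a - m a) * (pmf Q b - m b) / e" for a b
    using m(2)[of a] m(3)[of b] e by simp
  have f_eq: "f (a, b) = (if a = b then m a else 0) + (pmf P a - m a) * (pmf Q b - m b) / e" for a b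
    by (simp only: f_def prod.case)
  have f_nonneg: "0 \<le> f z" for z
  proof (cases z)
    case (Pair a b)
    show ?thesis
      unfolding Pair f_eq
      by (rule add_nonneg_nonneg[OF _ rest_nonneg]) (simp add: m(1))
  qed
  have f_outside: "f z = 0" if "z \<notin> S \<times> S" for z
    using that by (cases z) (auto simp: f_eq outside)
  have rows: "(\<Sum>b\<in>S. f (a, b)) = pmf P a" for a
  proof -
    have "(\<Sum>b\<in>S. f (a, b)) = (\<Sum>b\<in>S. if a = b then m a else 0) + (pmf P a - m a) * (\<Sum>b\<in>S. pmf Q b - m b) / e"
      by (simp add: f_eq sum.distrib sum_distrib_left sum_divide_distrib)
    also have "\<dots> = pmf P a"
      unfolding restQ using S outside[of a] e0(1)[of a] by (cases "a \<in> S"; cases "e = 0") auto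
    finally show ?thesis .
  qed
  have cols: "(\<Sum>a\<in>S. f (a, b)) = pmf Q b" for b
  proof -
    have "(\<Sum>a\<in>S. f (a, b)) = (\<Sum>a\<in>S. if a = b then m a else 0) + (\<Sum>a\<in>S. pmf P a - m a) * (pmf Q b - m b) / e"
      by (simp add: f_eq sum.distrib sum_distrib_right sum_divide_distrib)
    also have "\<dots> = pmf Q b"
      unfolding restP using S outside[of b] e0(2)[of b] by (cases "b \<in> S"; cases "e = 0") auto
    finally show ?thesis .
  qed
  have total: "sum f (S \<times> S) = 1"
  proof -
    have "sum f (S \<times> S) = (\<Sum>a\<in>S. \<Sum>b\<in>S. f (a, b))"
      unfolding sum.cartesian_product by (simp add: case_prod_beta)
    also have "\<dots> = 1"
      unfolding rows using S by (simp add: sum_pmf_eq_1 S_def)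
    finally show ?thesis .
  qed
  define c where "c = embed_pmf f"
  have c: "pmf c z = f z" for z
    unfolding c_def
  proof (rule pmf_embed_pmf[OF f_nonneg])
    have "(\<integral>\<^sup>+ z. ennreal (f z) \<partial>count_space UNIV) = (\<Sum>z\<in>S \<times> S. ennreal (f z))"
      using S f_outside by (intro nn_integral_count_space') auto
    also have "\<dots> = 1"
      by (simp add: sum_ennreal f_nonneg total)
    finally show "(\<integral>\<^sup>+ z. ennreal (f z) \<partial>count_space UNIV) = 1" .
  qed
  have prob: "measure_pmf.prob c X = sum f (X \<inter> S \<times> S)" for X
  proof -
    have "measure_pmf.prob c X = measure_pmf.prob c (X \<inter> S \<times> S)"
      by (intro measure_prob_cong_0) (use f_outside in \<open>auto simp: c\<close>)
    also have "\<dots> = sum f (X \<inter> S \<times> S)"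
      using S by (subst measure_measure_pmf_finite) (auto simp: c)
    finally show ?thesis .
  qed
  show thesis
  proof
    show "map_pmf fst c = P"
    proof (rule pmf_eqI)
      fix a
      have "pmf (map_pmf fst c) a = sum f (fst -` {a} \<inter> S \<times> S)"
        by (simp add: pmf_map prob)
      also have "\<dots> = (if a \<in> S then \<Sum>b\<in>S. f (a, b) else 0)"
      proof -
        have "fst -` {a} \<inter> S \<times> S = (if a \<in> S then Pair a ` S else {})" by auto
        then show ?thesis by (simp add: sum.reindex inj_on_def)
      qed
      finally show "pmf (map_pmf fst c) a = pmf P a"
        using outside[of a] by (simp add: rows split: if_splits)
    qed
    show "map_pmf snd c = Q"
    proof (rule pmf_eqI)
      fix b
      have "pmf (map_pmf snd c) b = sum f (snd -` {b} \<inter> S \<times> S)"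
        by (simp add: pmf_map prob)
      also have "\<dots> = (if b \<in> S then \<Sum>a\<in>S. f (a, b) else 0)"
      proof -
        have "snd -` {b} \<inter> S \<times> S = (if b \<in> S then (\<lambda>a. (a, b)) ` S else {})" by auto
        then show ?thesis by (simp add: sum.reindex inj_on_def)
      qed
      finally show "pmf (map_pmf snd c) b = pmf Q b"
        using outside[of b] by (simp add: cols split: if_splits)
    qed
    have "sum m S = (\<Sum>z\<in>(\<lambda>a. (a, a)) ` S. m (fst z))"
      by (simp add: sum.reindex inj_on_def)
    also have "\<dots> \<le> (\<Sum>z\<in>(\<lambda>a. (a, a)) ` S. f z)"
    proof (intro sum_mono)
      fix z assume "z \<in> (\<lambda>a. (a, a)) ` S"
      then obtain a where z: "z = (a, a)" by blast
      show "m (fst z) \<le> f z" unfolding z f_eq fst_conv using rest_nonneg[of a a] by simp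
    qed
    also have "(\<lambda>a. (a, a)) ` S = {z. fst z = snd z} \<inter> S \<times> S" by auto
    also have "sum f \<dots> = measure_pmf.prob c {z. fst z = snd z}" by (simp add: prob)
    also have "\<dots> = 1 - measure_pmf.prob c {z. fst z \<noteq> snd z}"
      by (subst measure_pmf.prob_compl[symmetric]) (auto intro!: arg_cong[where f = "measure_pmf.prob c"])
    finally have "measure_pmf.prob c {z. fst z \<noteq> snd z} \<le> e" by (simp add: e_def)
    also have "e = (\<Sum>a\<in>S. max 0 (pmf P a - pmf Q a))"
      unfolding restP[symmetric] by (intro sum.cong refl) (simp add: m_def max_def min_def)
    also have "\<dots> = (\<Sum>a\<in>set_pmf P. max 0 (pmf P a - pmf Q a))"
      using S by (intro sum.mono_neutral_right) (auto simp: S_def set_pmf_iff)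
    finally show "measure_pmf.prob c {z. fst z \<noteq> snd z} \<le> \<dots>" .
  qed
qed

text \<open>
  Here \<open>r\<close> is the law of (next coordinate, past). For each past \<open>b\<close> the conditional law of the next
  coordinate is coupled maximally with its marginal law. Averaging over \<open>b\<close> the distances between
  these laws gives the distance between \<open>r\<close> and the product of its marginals.
\<close>

lemma kernel_coupling:
  fixes r :: "('a \<times> 'b) pmf"
  assumes fin: "finite (set_pmf r)"
  obtains C where
    "\<And>b. b \<in> snd ` set_pmf r \<Longrightarrow> map_pmf fst (C b) = map_pmf fst (fibre_pmf r snd b)"
    "\<And>b. b \<in> snd ` set_pmf r \<Longrightarrow> map_pmf snd (C b) = map_pmf fst r"
    "measure_pmf.prob (bind_pmf (map_pmf snd r) C) {z. fst z \<noteq> snd z} \<le> dependence r"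
proof -
  let ?P = "\<lambda>b. map_pmf fst (fibre_pmf r snd b)" and ?Q = "map_pmf fst r"
  have finP: "finite (set_pmf (?P b))" if "b \<in> snd ` set_pmf r" for b
    using set_fibre_pmf[OF that] fin by simp
  have "\<forall>b\<in>snd ` set_pmf r. \<exists>c. map_pmf fst c = ?P b \<and> map_pmf snd c = ?Q \<and>
      measure_pmf.prob c {z. fst z \<noteq> snd z} \<le> (\<Sum>a\<in>set_pmf (?P b). max 0 (pmf (?P b) a - pmf ?Q a))"
  proof
    fix b assume b: "b \<in> snd ` set_pmf r"
    have "finite (set_pmf ?Q)" using fin by simp
    with finP[OF b] show "\<exists>c. map_pmf fst c = ?P b \<and> map_pmf snd c = ?Q \<and>
      measure_pmf.prob c {z. fst z \<noteq> snd z} \<le> (\<Sum>a\<in>set_pmf (?P b). max 0 (pmf (?P b) a - pmf ?Q a))"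
      by (rule maximal_coupling) blast
  qed
  from bchoice[OF this] obtain C where C: "\<And>b. b \<in> snd ` set_pmf r \<Longrightarrow> map_pmf fst (C b) = ?P b \<and> map_pmf snd (C b) = ?Q \<and>
      measure_pmf.prob (C b) {z. fst z \<noteq> snd z} \<le> (\<Sum>a\<in>set_pmf (?P b). max 0 (pmf (?P b) a - pmf ?Q a))"
    by blast
  have finC: "finite (set_pmf (C b))" if "b \<in> snd ` set_pmf r" for b
  proof (rule finite_subset)
    show "set_pmf (C b) \<subseteq> set_pmf (map_pmf fst (C b)) \<times> set_pmf (map_pmf snd (C b))" by force
    show "finite \<dots>" using C[OF that] finP[OF that] fin by (metis finite_SigmaI finite_imageI set_map_pmf)
  qed
  let ?A = "fst ` set_pmf r" and ?B = "snd ` set_pmf r"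
  have "measure_pmf.prob (bind_pmf (map_pmf snd r) C) {z. fst z \<noteq> snd z}
      = (\<Sum>b\<in>?B. pmf (map_pmf snd r) b * measure_pmf.prob (C b) {z. fst z \<noteq> snd z})"
    using fin finC by (intro prob_bind_pmf_finite) auto
  also have "\<dots> \<le> (\<Sum>b\<in>?B. \<Sum>a\<in>?A. max 0 (pmf r (a, b) - pmf ?Q a * pmf (map_pmf snd r) b))"
  proof (intro sum_mono)
    fix b assume b: "b \<in> ?B"
    have sub: "set_pmf (?P b) \<subseteq> ?A"
      using set_fibre_pmf[OF b] by auto
    have "measure_pmf.prob (C b) {z. fst z \<noteq> snd z} \<le> (\<Sum>a\<in>set_pmf (?P b). max 0 (pmf (?P b) a - pmf ?Q a))"
      using C[OF b] by blast
    also have "\<dots> \<le> (\<Sum>a\<in>?A. max 0 (pmf (?P b) a - pmf ?Q a))"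
      using sub fin by (intro sum_mono2) auto
    finally have "pmf (map_pmf snd r) b * measure_pmf.prob (C b) {z. fst z \<noteq> snd z}
        \<le> (\<Sum>a\<in>?A. pmf (map_pmf snd r) b * max 0 (pmf (?P b) a - pmf ?Q a))"
      by (simp add: mult_left_mono flip: sum_distrib_left)
    also have "\<dots> = (\<Sum>a\<in>?A. max 0 (pmf r (a, b) - pmf ?Q a * pmf (map_pmf snd r) b))"
      using pmf_fibre_joint[OF b, where g = fst]
      by (intro sum.cong refl) (simp add: map_pmf_ident max_mult_distrib_left algebra_simps)
    finally show "pmf (map_pmf snd r) b * measure_pmf.prob (C b) {z. fst z \<noteq> snd z} \<le> \<dots>" .
  qed
  also have "\<dots> = dependence r"
  proof (subst dependence_eq_sum_product)
    show "set_pmf r \<subseteq> ?A \<times> ?B" by force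
    show "(\<Sum>b\<in>?B. \<Sum>a\<in>?A. max 0 (pmf r (a, b) - pmf ?Q a * pmf (map_pmf snd r) b)) =
      (\<Sum>(a, b)\<in>?A \<times> ?B. max 0 (pmf r (a, b) - pmf ?Q a * pmf (map_pmf snd r) b))"
      by (subst sum.swap) (simp add: sum.cartesian_product)
  qed (use fin in auto)
  finally show thesis using C by (intro that[of C]) auto
qed

text \<open>
  By induction on the number of coordinates, with \<open>kernel_coupling\<close> as the step. The kernel used at
  each step depends only on the past of the first point, and whatever that past is, the new
  coordinate of the second point has the marginal law. So the second point has independent
  coordinates.
\<close>

lemma sequential_coupling:
  fixes p :: "(nat \<Rightarrow> 'a) pmf"
  assumes fin: "finite (set_pmf p)"
  shows "\<exists>q. map_pmf fst q = map_pmf (\<lambda>w. restrict w {1..n}) p \<and>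
    map_pmf snd q = Pi_pmf {1..n} undefined (\<lambda>i. map_pmf (\<lambda>w. w i) p) \<and>
    (\<forall>i\<in>{1..n}. measure_pmf.prob q {z. fst z i \<noteq> snd z i}
      \<le> dependence (map_pmf (\<lambda>w. (w i, restrict w {1..<i})) p))"
proof (induction n)
  case 0
  show ?case
    by (intro exI[of _ "return_pmf (\<lambda>_. undefined, \<lambda>_. undefined)"]) (simp add: restrict_def)
next
  case (Suc n)
  then obtain q where q1: "map_pmf fst q = map_pmf (\<lambda>w. restrict w {1..n}) p"
    and q2: "map_pmf snd q = Pi_pmf {1..n} undefined (\<lambda>i. map_pmf (\<lambda>w. w i) p)"
    and q3: "\<And>i. i \<in> {1..n} \<Longrightarrow> measure_pmf.prob q {z. fst z i \<noteq> snd z i}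
      \<le> dependence (map_pmf (\<lambda>w. (w i, restrict w {1..<i})) p)"
    by blast
  define r where "r = map_pmf (\<lambda>w. (w (Suc n), restrict w {1..n})) p"
  have r_fst: "map_pmf fst r = map_pmf (\<lambda>w. w (Suc n)) p"
    and r_snd: "map_pmf snd r = map_pmf fst q"
    unfolding r_def q1 by (simp_all add: pmf.map_comp comp_def)
  have fin_r: "finite (set_pmf r)" using fin by (simp add: r_def)
  obtain C where
    C1: "\<And>b. b \<in> snd ` set_pmf r \<Longrightarrow> map_pmf fst (C b) = map_pmf fst (fibre_pmf r snd b)"
    and C2: "\<And>b. b \<in> snd ` set_pmf r \<Longrightarrow> map_pmf snd (C b) = map_pmf fst r"
    and C3: "measure_pmf.prob (bind_pmf (map_pmf snd r) C) {z. fst z \<noteq> snd z} \<le> dependence r"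
    using kernel_coupling[OF fin_r] by blast
  have supp: "fst z \<in> snd ` set_pmf r" if "z \<in> set_pmf q" for z
    using that r_snd by (metis image_eqI set_map_pmf)
  \<comment> \<open>The pair is extended by a sample of the coupling kernel at the past of its first point.\<close>
  define q' where "q' = bind_pmf q (\<lambda>z. map_pmf (\<lambda>c. ((fst z)(Suc n := fst c), (snd z)(Suc n := snd c))) (C (fst z)))"
  have "map_pmf fst q' = bind_pmf q (\<lambda>z. map_pmf (\<lambda>a. (fst z)(Suc n := a)) (map_pmf fst (C (fst z))))"
    unfolding q'_def by (simp add: map_bind_pmf pmf.map_comp comp_def)
  also have "\<dots> = bind_pmf q (\<lambda>z. map_pmf (\<lambda>a. (fst z)(Suc n := a)) (map_pmf fst (fibre_pmf r snd (fst z))))"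
    by (intro bind_pmf_cong refl) (simp add: C1 supp)
  also have "\<dots> = bind_pmf (map_pmf snd r) (\<lambda>x. map_pmf (\<lambda>a. x(Suc n := a)) (map_pmf fst (fibre_pmf r snd x)))"
    unfolding r_snd by (simp add: bind_map_pmf)
  also have "\<dots> = bind_pmf (map_pmf snd r) (\<lambda>x. map_pmf (\<lambda>c. (snd c)(Suc n := fst c)) (fibre_pmf r snd x))"
  proof (intro bind_pmf_cong refl)
    fix x assume "x \<in> set_pmf (map_pmf snd r)"
    then have "set_pmf (fibre_pmf r snd x) \<subseteq> {c. snd c = x}"
      by (subst set_fibre_pmf) auto
    then show "map_pmf (\<lambda>a. x(Suc n := a)) (map_pmf fst (fibre_pmf r snd x))
        = map_pmf (\<lambda>c. (snd c)(Suc n := fst c)) (fibre_pmf r snd x)"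
      unfolding pmf.map_comp by (intro map_pmf_cong) auto
  qed
  also have "\<dots> = map_pmf (\<lambda>c. (snd c)(Suc n := fst c)) r"
    by (simp only: map_bind_pmf[symmetric] bind_fibre_pmf)
  also have "\<dots> = map_pmf (\<lambda>w. restrict w {1..Suc n}) p"
    unfolding r_def pmf.map_comp by (intro map_pmf_cong) (auto simp: restrict_def)
  finally have fst_q': "map_pmf fst q' = map_pmf (\<lambda>w. restrict w {1..Suc n}) p" .
  have "map_pmf snd q' = bind_pmf q (\<lambda>z. map_pmf (\<lambda>a. (snd z)(Suc n := a)) (map_pmf snd (C (fst z))))"
    unfolding q'_def by (simp add: map_bind_pmf pmf.map_comp comp_def)
  also have "\<dots> = bind_pmf q (\<lambda>z. map_pmf (\<lambda>a. (snd z)(Suc n := a)) (map_pmf fst r))"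
    by (intro bind_pmf_cong refl) (simp add: C2 supp)
  also have "\<dots> = bind_pmf (map_pmf snd q) (\<lambda>y. map_pmf (\<lambda>a. y(Suc n := a)) (map_pmf (\<lambda>w. w (Suc n)) p))"
    unfolding r_fst by (simp add: bind_map_pmf)
  also have "\<dots> = Pi_pmf (insert (Suc n) {1..n}) undefined (\<lambda>i. map_pmf (\<lambda>w. w i) p)"
    unfolding q2 by (subst Pi_pmf_insert', simp, simp, subst bind_commute_pmf) (simp add: map_pmf_def)
  also have "insert (Suc n) {1..n} = {1..Suc n}" by auto
  finally have snd_q': "map_pmf snd q' = Pi_pmf {1..Suc n} undefined (\<lambda>i. map_pmf (\<lambda>w. w i) p)" .
  \<comment> \<open>Whether the points differ at \<open>i\<close> depends only on the joint law of their \<open>i\<close>-th coordinates.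
    For \<open>i \<le> n\<close> the extension leaves that law unchanged; for \<open>i = Suc n\<close> it is the averaged
    kernel.\<close>
  have eval: "measure_pmf.prob s {z. fst z i \<noteq> snd z i}
      = measure_pmf.prob (map_pmf (\<lambda>z. (fst z i, snd z i)) s) {c. fst c \<noteq> snd c}"
    for i and s :: "((nat \<Rightarrow> 'a) \<times> (nat \<Rightarrow> 'a)) pmf"
    by (simp add: vimage_def)
  have "measure_pmf.prob q' {z. fst z i \<noteq> snd z i} \<le> dependence (map_pmf (\<lambda>w. (w i, restrict w {1..<i})) p)"
    if i: "i \<in> {1..Suc n}" for i
  proof (cases "i = Suc n")
    case True
    have "map_pmf (\<lambda>z. (fst z i, snd z i)) q' = bind_pmf (map_pmf fst q) C"
      unfolding q'_def True by (simp add: map_bind_pmf pmf.map_comp comp_def bind_map_pmf map_pmf_ident)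
    then show ?thesis
      using C3 unfolding eval r_snd[symmetric] True r_def by (simp add: atLeastLessThanSuc_atLeastAtMost)
  next
    case False
    have "map_pmf (\<lambda>z. (fst z i, snd z i)) q' = map_pmf (\<lambda>z. (fst z i, snd z i)) q"
      unfolding q'_def using False by (simp add: map_bind_pmf pmf.map_comp comp_def map_pmf_def[of _ q] map_pmf_const)
    then show ?thesis
      using q3[of i] i False unfolding eval by simp
  qed
  with fst_q' snd_q' show ?case by blast
qed

section \<open>Choosing the coordinates to condition on\<close>

text \<open>
  Entropy depends on a random variable only through the partition into its level sets.
\<close>

lemma pmf_entropy_map_cong:
  assumes "\<And>w w'. w \<in> set_pmf p \<Longrightarrow> w' \<in> set_pmf p \<Longrightarrow> f w = f w' \<longleftrightarrow> g w = g w'"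
  shows "pmf_entropy (map_pmf f p) = pmf_entropy (map_pmf g p)"
  unfolding pmf_entropy_map
proof (intro integral_cong_AE AE_pmfI)
  fix w assume w: "w \<in> set_pmf p"
  have "measure_pmf.prob p (f -` {f w}) = measure_pmf.prob p (g -` {g w})"
    using assms[OF w] by (intro measure_pmf.finite_measure_eq_AE AE_pmfI) (auto simp: eq_commute)
  then show "- ln (pmf (map_pmf f p) (f w)) = - ln (pmf (map_pmf g p) (g w))"
    by (simp add: pmf_map)
qed auto

definition coord_entropy :: "('i \<Rightarrow> 'a) pmf \<Rightarrow> 'i set \<Rightarrow> real"
  where "coord_entropy p J = pmf_entropy (map_pmf (\<lambda>w. restrict w J) p)"

lemma coord_entropy_eqI:
  assumes "\<And>w w'. w \<in> set_pmf p \<Longrightarrow> w' \<in> set_pmf p \<Longrightarrow> f w = f w' \<longleftrightarrow> (\<forall>j\<in>J. w j = w' j)"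
  shows "pmf_entropy (map_pmf f p) = coord_entropy p J"
  unfolding coord_entropy_def
  by (rule pmf_entropy_map_cong) (auto simp: assms restrict_def fun_eq_iff)

lemma restrict_eq_restrict_iff: "restrict w J = restrict w' J \<longleftrightarrow> (\<forall>j\<in>J. w j = w' j)"
  by (auto simp: restrict_def fun_eq_iff)

text \<open>
  This says that the conditional mutual information of \<open>X\<^sub>A\<close> and \<open>X\<^sub>B\<close> given \<open>X\<^sub>C\<close> is nonnegative,
  with every tuple of coordinates encoded by its set of indices.
\<close>

lemma coord_entropy_submodular:
  assumes "finite (set_pmf p)"
  shows "coord_entropy p (A \<union> B \<union> C) + coord_entropy p C
    \<le> coord_entropy p (A \<union> C) + coord_entropy p (B \<union> C)"
proof -
  let ?h = "\<lambda>w. restrict w C" and ?f = "\<lambda>w. restrict w A" and ?g = "\<lambda>w. restrict w B"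
  have "0 \<le> pmf_entropy (map_pmf (\<lambda>w. (?f w, ?h w)) p) + pmf_entropy (map_pmf (\<lambda>w. (?g w, ?h w)) p)
      - pmf_entropy (map_pmf (\<lambda>w. ((?f w, ?g w), ?h w)) p) - pmf_entropy (map_pmf ?h p)"
    by (rule order_trans[OF zero_le_power2 mean_dependence_square_le[OF assms]])
  moreover have "pmf_entropy (map_pmf (\<lambda>w. (?f w, ?h w)) p) = coord_entropy p (A \<union> C)"
    "pmf_entropy (map_pmf (\<lambda>w. (?g w, ?h w)) p) = coord_entropy p (B \<union> C)"
    "pmf_entropy (map_pmf (\<lambda>w. ((?f w, ?g w), ?h w)) p) = coord_entropy p (A \<union> B \<union> C)"
    by (rule coord_entropy_eqI; auto simp: restrict_eq_restrict_iff)+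
  ultimately show ?thesis by (simp add: coord_entropy_def)
qed

text \<open>
  The chain rule turns this conditional entropy into a difference of joint entropies.
\<close>

definition coord_entropy_given_rest :: "('i \<Rightarrow> 'a) pmf \<Rightarrow> 'i set \<Rightarrow> 'i \<Rightarrow> real"
  where "coord_entropy_given_rest p I i = coord_entropy p I - coord_entropy p (I - {i})"

text \<open>
  Conditioning on the coordinates in \<open>S\<close> only, instead of on all but \<open>i\<close>, cannot decrease entropy.
\<close>

lemma coord_entropy_given_rest_le:
  assumes fin: "finite (set_pmf p)" and "i \<in> I" "S \<subseteq> I - {i}"
  shows "coord_entropy_given_rest p I i \<le> coord_entropy p (insert i S) - coord_entropy p S"
proof -
  have "{i} \<union> (I - {i}) \<union> S = I" "{i} \<union> S = insert i S" "(I - {i}) \<union> S = I - {i}"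
    using assms by auto
  then show ?thesis
    using coord_entropy_submodular[OF fin, of "{i}" "I - {i}" S]
    by (simp add: coord_entropy_given_rest_def)
qed

text \<open>
  With \<open>T = I - S\<close> this is the nonnegativity of the dual total correlation conditionally on \<open>X\<^sub>S\<close>.
\<close>

lemma sum_coord_entropy_given_rest_le:
  assumes fin: "finite (set_pmf p)" and "finite T" "T \<subseteq> I" "S \<subseteq> I - T"
  shows "sum (coord_entropy_given_rest p I) T \<le> coord_entropy p (S \<union> T) - coord_entropy p S"
  using assms(2-)
proof (induction T rule: finite_induct)
  case (insert i T)
  then have "coord_entropy_given_rest p I i \<le> coord_entropy p (insert i (S \<union> T)) - coord_entropy p (S \<union> T)"
    by (intro coord_entropy_given_rest_le[OF fin]) auto
  moreover have "sum (coord_entropy_given_rest p I) T \<le> coord_entropy p (S \<union> T) - coord_entropy p S"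
    using insert by blast
  ultimately show ?case using insert by simp
qed simp

text \<open>
  The quantity \<open>D S\<close> of the proof is the dual total correlation conditionally on \<open>X\<^sub>S\<close>. Among the
  sets that lower \<open>D\<close> from its initial value \<open>D {}\<close> by at least \<open>\<epsilon>\<close> per element, a maximal one
  is taken; \<open>D S \<ge> 0\<close> then bounds its size. Adding \<open>i\<close> to it lowers \<open>D\<close> by the difference in the last conclusion, the information
  between \<open>X\<^sub>i\<close> and the other coordinates given \<open>X\<^sub>S\<close>, which by maximality is less than \<open>\<epsilon>\<close>.
\<close>

lemma exists_conditioning_set:
  fixes \<epsilon> :: real
  assumes fin: "finite (set_pmf p)" and I: "finite I" and \<epsilon>: "\<epsilon> > 0"
  obtains S where "S \<subseteq> I"
    "\<epsilon> * card S \<le> coord_entropy p I - sum (coord_entropy_given_rest p I) I"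
    "\<And>i. i \<in> I - S \<Longrightarrow> coord_entropy p (insert i S) - coord_entropy p S - coord_entropy_given_rest p I i < \<epsilon>"
proof -
  let ?h = "coord_entropy p" and ?c = "coord_entropy_given_rest p I"
  define D where "D S = ?h I - ?h S - sum ?c (I - S)" for S
  let ?F = "{S. S \<subseteq> I \<and> D S + \<epsilon> * card S \<le> D {}}"
  have "finite ?F" using I by simp
  moreover have "{} \<in> ?F" by simp
  then have "?F \<noteq> {}" by blast
  ultimately obtain S where S: "S \<in> ?F" and maximal: "\<forall>T\<in>?F. S \<subseteq> T \<longrightarrow> S = T"
    by (rule finite_has_maximal[THEN bexE])
  have fS: "finite S" using S I finite_subset by auto
  have "0 \<le> D S"
    using sum_coord_entropy_given_rest_le[OF fin, of "I - S" I S] S I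
    by (simp add: D_def Un_absorb1 double_diff)
  moreover have "D {} = ?h I - sum ?c I"
    by (simp add: D_def coord_entropy_def pmf_entropy_def restrict_def)
  ultimately have "\<epsilon> * card S \<le> ?h I - sum ?c I"
    using S by simp
  moreover have "?h (insert i S) - ?h S - ?c i < \<epsilon>" if i: "i \<in> I - S" for i
  proof -
    have "insert i S \<notin> ?F" using maximal i by blast
    then have "D {} < D (insert i S) + \<epsilon> * (card S + 1)"
      using S i fS by (auto simp: algebra_simps)
    then have "D S - D (insert i S) < \<epsilon>"
      using S by (simp add: algebra_simps)
    moreover have "sum ?c (I - S) = ?c i + sum ?c (I - insert i S)"
      using i I by (metis Diff_insert finite_Diff sum.remove)
    ultimately show ?thesis by (simp add: D_def)
  qed
  ultimately show thesis using that S by blast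
qed

text \<open>
  For \<open>i\<close> outside \<open>S\<close>, the information between \<open>X\<^sub>i\<close> and the earlier coordinates is at most that
  between \<open>X\<^sub>i\<close> and all the others. For \<open>i\<close> in \<open>S\<close> it vanishes, as \<open>X\<^sub>i\<close> is then constant on each
  fibre.
\<close>

lemma exists_conditioning_set_small_dependence:
  fixes p :: "(nat \<Rightarrow> 'a) pmf" and \<delta> :: real
  assumes fin: "finite (set_pmf p)" and \<delta>: "\<delta> > 0"
  obtains S where "S \<subseteq> {1..n}"
    "\<delta>\<^sup>2 * card S \<le> coord_entropy p {1..n} - sum (coord_entropy_given_rest p {1..n}) {1..n}"
    "\<And>i. i \<in> {1..n} \<Longrightarrow>
      (\<Sum>z\<in>(\<lambda>w. restrict w S) ` set_pmf p. pmf (map_pmf (\<lambda>w. restrict w S) p) z *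
         dependence (map_pmf (\<lambda>w. (w i, restrict w {1..<i})) (fibre_pmf p (\<lambda>w. restrict w S) z))) < \<delta>"
proof -
  let ?I = "{1..n}" and ?h = "coord_entropy p"
  have "\<delta>\<^sup>2 > 0" using \<delta> by simp
  then obtain S where S: "S \<subseteq> ?I"
    "\<delta>\<^sup>2 * card S \<le> ?h ?I - sum (coord_entropy_given_rest p ?I) ?I"
    and gain: "\<And>i. i \<in> ?I - S \<Longrightarrow> ?h (insert i S) - ?h S - coord_entropy_given_rest p ?I i < \<delta>\<^sup>2"
    using exists_conditioning_set[OF fin, of ?I "\<delta>\<^sup>2"] by blast
  have "(\<Sum>z\<in>(\<lambda>w. restrict w S) ` set_pmf p. pmf (map_pmf (\<lambda>w. restrict w S) p) z *
         dependence (map_pmf (\<lambda>w. (w i, restrict w {1..<i})) (fibre_pmf p (\<lambda>w. restrict w S) z))) < \<delta>"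
    (is "?E < \<delta>") if i: "i \<in> ?I" for i
  proof -
    let ?f = "\<lambda>w. w i" and ?g = "\<lambda>w. restrict w {1..<i}" and ?s = "\<lambda>w. restrict w S"
    let ?J = "{1..<i} \<union> S"
    have "?E\<^sup>2 \<le> pmf_entropy (map_pmf (\<lambda>w. (?f w, ?s w)) p) + pmf_entropy (map_pmf (\<lambda>w. (?g w, ?s w)) p)
      - pmf_entropy (map_pmf (\<lambda>w. ((?f w, ?g w), ?s w)) p) - pmf_entropy (map_pmf ?s p)"
      by (rule mean_dependence_square_le[OF fin])
    also have "pmf_entropy (map_pmf (\<lambda>w. (?f w, ?s w)) p) = ?h (insert i S)"
      by (rule coord_entropy_eqI) (auto simp: restrict_eq_restrict_iff)
    also have "pmf_entropy (map_pmf (\<lambda>w. (?g w, ?s w)) p) = ?h ?J"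
      by (rule coord_entropy_eqI) (auto simp: restrict_eq_restrict_iff)
    also have "pmf_entropy (map_pmf (\<lambda>w. ((?f w, ?g w), ?s w)) p) = ?h (insert i ?J)"
      by (rule coord_entropy_eqI) (auto simp: restrict_eq_restrict_iff)
    also have "pmf_entropy (map_pmf ?s p) = ?h S"
      by (simp add: coord_entropy_def)
    also have "?h (insert i S) + ?h ?J - ?h (insert i ?J) - ?h S < \<delta>\<^sup>2"
    proof (cases "i \<in> S")
      case True
      then have "insert i S = S" "insert i ?J = ?J" by auto
      then show ?thesis using \<delta> by simp
    next
      case False
      have "?J \<subseteq> ?I - {i}" using S(1) i False by auto
      from coord_entropy_given_rest_le[OF fin i this] gain[of i] i False show ?thesis by simp
    qed
    finally have "?E\<^sup>2 < \<delta>\<^sup>2" .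
    then show ?thesis by (rule power2_less_imp_less) (use \<delta> in simp)
  qed
  with S show thesis using that by blast
qed

section \<open>From probability mass functions to measures on finite products\<close>

text \<open>
  The measures of the theorem have a finite product set as their space, whereas a mass function is a
  measure on the whole type; the two are matched by restricting the latter.
\<close>

definition pmf_on :: "'a set \<Rightarrow> 'a pmf \<Rightarrow> 'a measure"
  where "pmf_on A p = restrict_space (measure_pmf p) A"

lemma space_pmf_on [simp]: "space (pmf_on A p) = A"
  by (simp add: pmf_on_def space_restrict_space)

lemma sets_pmf_on [simp]: "sets (pmf_on A p) = Pow A"
  by (auto simp: pmf_on_def sets_restrict_space image_def)

lemma emeasure_pmf_on: "X \<subseteq> A \<Longrightarrow> emeasure (pmf_on A p) X = emeasure (measure_pmf p) X"
  by (simp add: pmf_on_def emeasure_restrict_space)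

lemma measure_pmf_on: "X \<subseteq> A \<Longrightarrow> measure (pmf_on A p) X = measure_pmf.prob p X"
  by (simp add: measure_def emeasure_pmf_on)

lemma emeasure_pmf_Int_support:
  "set_pmf p \<subseteq> A \<Longrightarrow> emeasure (measure_pmf p) (X \<inter> A) = emeasure (measure_pmf p) X"
  by (rule emeasure_eq_AE) (auto simp: AE_measure_pmf_iff)

lemma prob_pmf_Int_support:
  "set_pmf p \<subseteq> A \<Longrightarrow> measure_pmf.prob p (X \<inter> A) = measure_pmf.prob p X"
  by (simp add: measure_def emeasure_pmf_Int_support)

lemma prob_space_pmf_on:
  assumes "set_pmf p \<subseteq> A"
  shows "prob_space (pmf_on A p)"
proof (rule prob_spaceI)
  show "emeasure (pmf_on A p) (space (pmf_on A p)) = 1"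
    using emeasure_pmf_Int_support[OF assms, of UNIV] by (simp add: emeasure_pmf_on)
qed

lemma distr_pmf_on:
  assumes "sets N = Pow B" "set_pmf p \<subseteq> A" "f \<in> A \<rightarrow> B"
  shows "distr (pmf_on A p) N f = pmf_on B (map_pmf f p)"
proof (rule measure_eqI)
  have N: "space N = B" using assms(1) by (metis sets_eq_imp_space_eq space_count_space sets_count_space)
  fix X assume "X \<in> sets (distr (pmf_on A p) N f)"
  then have X: "X \<subseteq> B" by (simp add: assms(1))
  have "f \<in> measurable (pmf_on A p) N"
    using assms(3) by (auto simp: measurable_def N assms(1))
  then have "emeasure (distr (pmf_on A p) N f) X = emeasure (measure_pmf p) (f -` X \<inter> A)"
    using X by (simp add: emeasure_distr assms(1) emeasure_pmf_on)
  also have "\<dots> = emeasure (pmf_on B (map_pmf f p)) X"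
    using X emeasure_pmf_Int_support[OF assms(2), of "f -` X"] by (simp add: emeasure_pmf_on)
  finally show "emeasure (distr (pmf_on A p) N f) X = emeasure (pmf_on B (map_pmf f p)) X" .
qed (simp add: assms(1))

lemma sets_pair_pmf_on:
  assumes "finite A" "finite B"
  shows "sets (pmf_on A p \<Otimes>\<^sub>M pmf_on B q) = Pow (A \<times> B)"
proof -
  have "sets (pmf_on A p \<Otimes>\<^sub>M pmf_on B q) = sets (count_space A \<Otimes>\<^sub>M count_space B)"
    by (intro sets_pair_measure_cong) auto
  then show ?thesis unfolding pair_measure_count_space[OF assms] by simp
qed

text \<open>
  The product sigma-algebra is generated by boxes, but singletons are boxes, and there are finitely
  many of them.
\<close>

lemma sets_PiM_Pow:
  assumes I: "finite I" and K: "\<And>i. i \<in> I \<Longrightarrow> finite (K i)" and M: "\<And>i. i \<in> I \<Longrightarrow> sets (M i) = Pow (K i)"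
  shows "sets (PiM I M) = Pow (PiE I K)"
proof (intro antisym subsetI)
  have sp: "space (M i) = K i" if "i \<in> I" for i
    using M[OF that] by (metis sets_eq_imp_space_eq space_count_space sets_count_space)
  have space: "space (PiM I M) = PiE I K"
    unfolding space_PiM using sp by (intro PiE_cong) auto
  fix X
  { assume "X \<in> sets (PiM I M)" then show "X \<in> Pow (PiE I K)" using space sets.sets_into_space by fast }
  assume X: "X \<in> Pow (PiE I K)"
  have "finite (PiE I K)" by (rule finite_PiE[OF I K])
  then have "finite X" using X by (auto intro: finite_subset)
  moreover have "{w} \<in> sets (PiM I M)" if "w \<in> X" for w
  proof -
    have "PiE I (\<lambda>i. {w i}) \<in> sets (PiM I M)"
      using I X that M by (intro sets_PiM_I_finite) (auto simp: PiE_iff)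
    moreover have "PiE I (\<lambda>i. {w i}) = {w}"
      using X that by (intro PiE_singleton) (auto simp: PiE_iff)
    ultimately show ?thesis by simp
  qed
  ultimately have "(\<Union>w\<in>X. {w}) \<in> sets (PiM I M)" by (intro sets.finite_UN) auto
  then show "X \<in> sets (PiM I M)" by simp
qed

lemma PiM_pmf_on:
  assumes I: "finite I" and K: "\<And>i. i \<in> I \<Longrightarrow> finite (K i)" and \<eta>: "\<And>i. i \<in> I \<Longrightarrow> set_pmf (\<eta> i) \<subseteq> K i"
  shows "PiM I (\<lambda>i. pmf_on (K i) (\<eta> i)) = pmf_on (PiE I K) (Pi_pmf I undefined \<eta>)"
proof (rule measure_eqI_finite)
  show sets: "sets (PiM I (\<lambda>i. pmf_on (K i) (\<eta> i))) = Pow (PiE I K)"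
    by (rule sets_PiM_Pow[OF I K]) auto
  fix w assume w: "w \<in> PiE I K"
  let ?M = "\<lambda>i. pmf_on (K i) (\<eta> i)"
  have "{w} = PiE I (\<lambda>i. {w i})"
    using w by (intro PiE_singleton[symmetric]) (auto simp: PiE_iff)
  also have "\<dots> = prod_emb I ?M I (PiE I (\<lambda>i. {w i}))"
    using w by (intro prod_emb_id[symmetric] PiE_mono) (auto simp: PiE_iff)
  finally have "emeasure (PiM I ?M) {w} = emeasure (PiM I ?M) \<dots>" by simp
  also have "\<dots> = (\<Prod>i\<in>I. emeasure (?M i) {w i})"
    using w I \<eta> by (intro emeasure_PiM_emb prob_space_pmf_on) (auto simp: PiE_iff)
  also have "\<dots> = (\<Prod>i\<in>I. ennreal (pmf (\<eta> i) (w i)))"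
    using w by (intro prod.cong refl) (auto simp: emeasure_pmf_on PiE_iff emeasure_pmf_single)
  also have "\<dots> = ennreal (\<Prod>i\<in>I. pmf (\<eta> i) (w i))"
    by (intro prod_ennreal) simp
  also have "\<dots> = ennreal (pmf (Pi_pmf I undefined \<eta>) w)"
    using w by (subst pmf_Pi'[OF I]) (auto simp: PiE_iff extensional_def)
  also have "\<dots> = emeasure (pmf_on (PiE I K) (Pi_pmf I undefined \<eta>)) {w}"
    using w by (simp add: emeasure_pmf_on emeasure_pmf_single)
  finally show "emeasure (PiM I ?M) {w} = \<dots>" .
qed (use finite_PiE[OF I K] in auto)

lemma ex_pmf_on:
  assumes A: "finite A" and \<mu>: "sets \<mu> = Pow A" "prob_space \<mu>"
  obtains p where "set_pmf p \<subseteq> A" "\<mu> = pmf_on A p"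
proof -
  interpret prob_space \<mu> by fact
  have sp: "space \<mu> = A" using \<mu>(1) by (metis sets_eq_imp_space_eq space_count_space sets_count_space)
  define p where "p = embed_pmf (\<lambda>w. measure \<mu> {w})"
  have outside: "measure \<mu> {w} = 0" if "w \<notin> A" for w
    using that \<mu>(1) by (intro measure_notin_sets) auto
  have p: "pmf p w = measure \<mu> {w}" for w
    unfolding p_def
  proof (rule pmf_embed_pmf)
    have "(\<integral>\<^sup>+ w. ennreal (measure \<mu> {w}) \<partial>count_space UNIV) = (\<Sum>w\<in>A. ennreal (measure \<mu> {w}))"
      using A outside by (intro nn_integral_count_space') auto
    also have "\<dots> = ennreal (\<Sum>w\<in>A. measure \<mu> {w})" by (simp add: sum_ennreal)
    also have "(\<Sum>w\<in>A. measure \<mu> {w}) = measure \<mu> A"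
      using A by (intro finite_measure_eq_sum_singleton[symmetric]) (auto simp: \<mu>(1))
    finally show "(\<integral>\<^sup>+ w. ennreal (measure \<mu> {w}) \<partial>count_space UNIV) = 1"
      using prob_space by (simp add: sp)
  qed simp
  show thesis
  proof
    show "set_pmf p \<subseteq> A" using outside unfolding set_pmf_iff p[symmetric] by (metis set_pmf_iff subsetI)
    show "\<mu> = pmf_on A p"
      using A by (intro measure_eqI_finite[of _ A])
        (auto simp: \<mu>(1) emeasure_pmf_on emeasure_pmf_single p emeasure_eq_measure)
  qed
qed

text \<open>
  Entropy with respect to counting measure on the range agrees with the entropy of the image mass
  function. Points of the range with probability zero drop out because \<open>0 * ln 0 = 0\<close>.
\<close>

lemma entropy_pmf_on:
  assumes A: "finite A" and p: "set_pmf p \<subseteq> A"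
  shows "prob_space.entropy (pmf_on A p) (exp 1) (count_space (f ` A)) f = pmf_entropy (map_pmf f p)"
proof -
  interpret prob_space "pmf_on A p" by (rule prob_space_pmf_on[OF p])
  interpret information_space "pmf_on A p" "exp 1" by unfold_locales simp
  have sf: "simple_function (pmf_on A p) f" using A by (auto simp: simple_function_def)
  have prob: "prob (f -` {x} \<inter> A) = pmf (map_pmf f p) x" for x
    by (simp add: measure_pmf_on prob_pmf_Int_support[OF p] pmf_map)
  have fin: "finite (set_pmf p)" using A p finite_subset by blast
  have "entropy (exp 1) (count_space (f ` A)) f
      = - (\<Sum>x\<in>f ` A. pmf (map_pmf f p) x * log (exp 1) (pmf (map_pmf f p) x))"
    using entropy_simple_distributed[OF simple_distributedI[OF sf measure_nonneg refl]]
    unfolding space_pmf_on prob .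
  also have "\<dots> = - (\<Sum>x\<in>set_pmf (map_pmf f p). pmf (map_pmf f p) x * ln (pmf (map_pmf f p) x))"
  proof (intro arg_cong[where f = uminus] sum.mono_neutral_cong_right)
    show "set_pmf (map_pmf f p) \<subseteq> f ` A" using p by auto
    show "\<forall>x\<in>f ` A - set_pmf (map_pmf f p). pmf (map_pmf f p) x * log (exp 1) (pmf (map_pmf f p) x) = 0"
      by (metis DiffE mult_zero_left set_pmf_iff)
  qed (use A in \<open>auto simp: log_def\<close>)
  also have "\<dots> = pmf_entropy (map_pmf f p)"
    using fin by (simp add: pmf_entropy_def expectation_finite_pmf sum_negf del: integral_map_pmf)
  finally show ?thesis .
qed

text \<open>
  Each conditional entropy in the definition of DTC is removed by the chain rule; the pair formed by
  coordinate \<open>i\<close> and the others determines, and is determined by, the whole tuple.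
\<close>

lemma DTC_pmf_on:
  assumes I: "finite I" and K: "\<And>i. i \<in> I \<Longrightarrow> finite (K i)" and p: "set_pmf p \<subseteq> PiE I K"
  shows "DTC I (pmf_on (PiE I K) p) = coord_entropy p I - sum (coord_entropy_given_rest p I) I"
proof -
  let ?A = "PiE I K" and ?t = "\<lambda>J w. restrict w J"
  have A: "finite ?A" by (rule finite_PiE[OF I K])
  interpret prob_space "pmf_on ?A p" by (rule prob_space_pmf_on[OF p])
  interpret information_space "pmf_on ?A p" "exp 1" by unfold_locales simp
  have "conditional_entropy (exp 1) (count_space ((\<lambda>w. w i) ` space (pmf_on ?A p)))
      (count_space (?t (I - {i}) ` space (pmf_on ?A p))) (\<lambda>w. w i) (?t (I - {i})) = coord_entropy_given_rest p I i"
    if i: "i \<in> I" for i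
  proof -
    have sf1: "simple_function (pmf_on ?A p) (\<lambda>w. w i)" and sf2: "simple_function (pmf_on ?A p) (?t (I - {i}))"
      using A by (auto simp: simple_function_def)
    have "pmf_entropy (map_pmf (\<lambda>w. (?t (I - {i}) w, w i)) p) = pmf_entropy (map_pmf (?t (I - {i})) p)
      + conditional_entropy (exp 1) (count_space ((\<lambda>w. w i) ` space (pmf_on ?A p)))
      (count_space (?t (I - {i}) ` space (pmf_on ?A p))) (\<lambda>w. w i) (?t (I - {i}))"
      using entropy_chain_rule[OF sf2 sf1]
      unfolding entropy_pmf_on[OF A p, unfolded space_pmf_on] space_pmf_on .
    moreover have "pmf_entropy (map_pmf (\<lambda>w. (?t (I - {i}) w, w i)) p) = coord_entropy p I"
      by (rule coord_entropy_eqI) (use i in \<open>auto simp: restrict_eq_restrict_iff\<close>)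
    ultimately show ?thesis by (simp add: coord_entropy_given_rest_def coord_entropy_def)
  qed
  moreover have "entropy (exp 1) (count_space (?t I ` space (pmf_on ?A p))) (?t I) = coord_entropy p I"
    unfolding space_pmf_on entropy_pmf_on[OF A p] coord_entropy_def ..
  ultimately show ?thesis
    unfolding DTC_def dual_total_correlation_def Let_def by simp
qed

text \<open>
  The cost of a single coupling bounds the infimum, because costs of couplings are bounded below.
\<close>

lemma transport_dist_le:
  assumes A: "finite A"
    and q: "set_pmf q \<subseteq> A \<times> A" "map_pmf fst q = p1" "map_pmf snd q = p2"
    and c0: "\<And>x y. 0 \<le> c x y"
  shows "transport_dist c (pmf_on A p1) (pmf_on A p2) \<le> measure_pmf.expectation q (\<lambda>z. c (fst z) (snd z))"
proof -
  let ?\<gamma> = "pmf_on (A \<times> A) q"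
  have marginals: "distr ?\<gamma> (pmf_on A p1) fst = pmf_on A p1" "distr ?\<gamma> (pmf_on A p2) snd = pmf_on A p2"
    unfolding q(2,3)[symmetric] by (auto intro!: distr_pmf_on[OF _ q(1)])
  have "?\<gamma> \<in> couplings (pmf_on A p1) (pmf_on A p2)"
    unfolding couplings_def space_prob_algebra
    using q(1) by (auto simp: sets_pair_pmf_on A marginals prob_space_pmf_on)
  moreover have "bdd_below ((\<lambda>\<gamma>. \<integral>z. c (fst z) (snd z) \<partial>\<gamma>) ` couplings (pmf_on A p1) (pmf_on A p2))"
    by (intro bdd_belowI2[of _ 0] Bochner_Integration.integral_nonneg c0)
  ultimately have "transport_dist c (pmf_on A p1) (pmf_on A p2) \<le> (\<integral>z. c (fst z) (snd z) \<partial>?\<gamma>)"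
    unfolding transport_dist_def by (intro cINF_lower)
  also have "\<dots> = measure_pmf.expectation q (\<lambda>z. indicator (A \<times> A) z *\<^sub>R c (fst z) (snd z))"
    unfolding pmf_on_def by (rule integral_restrict_space) simp
  also have "\<dots> = measure_pmf.expectation q (\<lambda>z. c (fst z) (snd z))"
    using q(1) by (intro integral_cong_AE AE_pmfI) (auto split: split_indicator)
  finally show ?thesis .
qed

text \<open>
  Since the metrics are bounded by \<open>1\<close> and vanish on the diagonal, the cost of the sequential
  coupling is at most the mean number of coordinates on which its two points differ.
\<close>

lemma transport_dist_product_le_dependence:
  fixes p :: "(nat \<Rightarrow> 'a) pmf"
  assumes d: "\<And>i. i \<in> {1..n} \<Longrightarrow> Metric_space (K i) (d i)"
    and K: "\<And>i. i \<in> {1..n} \<Longrightarrow> finite (K i)"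
    and diam: "\<And>i x y. i \<in> {1..n} \<Longrightarrow> x \<in> K i \<Longrightarrow> y \<in> K i \<Longrightarrow> d i x y \<le> 1"
    and p: "set_pmf p \<subseteq> PiE {1..n} K"
  shows "transport_dist (mean_dist n d) (pmf_on (PiE {1..n} K) p)
      (\<Pi>\<^sub>M i\<in>{1..n}. pmf_on (K i) (map_pmf (\<lambda>w. w i) p))
    \<le> 1 / real n * (\<Sum>i=1..n. dependence (map_pmf (\<lambda>w. (w i, restrict w {1..<i})) p))"
proof -
  let ?A = "PiE {1..n} K"
  have A: "finite ?A" using K by (intro finite_PiE) auto
  have fin: "finite (set_pmf p)" using A p finite_subset by blast
  obtain q where q1: "map_pmf fst q = map_pmf (\<lambda>w. restrict w {1..n}) p"
    and q2: "map_pmf snd q = Pi_pmf {1..n} undefined (\<lambda>i. map_pmf (\<lambda>w. w i) p)"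
    and q3: "\<And>i. i \<in> {1..n} \<Longrightarrow> measure_pmf.prob q {z. fst z i \<noteq> snd z i}
      \<le> dependence (map_pmf (\<lambda>w. (w i, restrict w {1..<i})) p)"
    using sequential_coupling[OF fin, of n] by blast
  have marg: "set_pmf (map_pmf (\<lambda>w. w i) p) \<subseteq> K i" if "i \<in> {1..n}" for i
    using p that by (auto simp: PiE_iff subset_eq)
  have "map_pmf (\<lambda>w. restrict w {1..n}) p = map_pmf (\<lambda>w. w) p"
  proof (intro map_pmf_cong refl)
    fix w assume "w \<in> set_pmf p"
    then show "restrict w {1..n} = w" using p by (intro PiE_restrict) blast
  qed
  then have q1': "map_pmf fst q = p" using q1 by simp
  have "set_pmf (map_pmf snd q) \<subseteq> ?A"
  proof
    fix w assume "w \<in> set_pmf (map_pmf snd q)"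
    then have "w \<in> PiE_dflt {1..n} undefined (set_pmf \<circ> (\<lambda>i. map_pmf (\<lambda>w. w i) p))"
      unfolding q2 by (rule subsetD[OF set_Pi_pmf_subset'[OF finite_atLeastAtMost]])
    then show "w \<in> ?A"
      using marg unfolding PiE_dflt_def PiE_iff extensional_def comp_def by blast
  qed
  moreover have "set_pmf (map_pmf fst q) \<subseteq> ?A" unfolding q1' by (rule p)
  moreover have "set_pmf q \<subseteq> set_pmf (map_pmf fst q) \<times> set_pmf (map_pmf snd q)" by force
  ultimately have q: "set_pmf q \<subseteq> ?A \<times> ?A" by blast
  have finq: "finite (set_pmf q)" using q A finite_subset by blast
  have d0: "0 \<le> d i x y" if "i \<in> {1..n}" for i x y
    using d[OF that] by (rule Metric_space.nonneg)
  have product: "(\<Pi>\<^sub>M i\<in>{1..n}. pmf_on (K i) (map_pmf (\<lambda>w. w i) p)) = pmf_on ?A (map_pmf snd q)"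
    unfolding q2 by (rule PiM_pmf_on[OF finite_atLeastAtMost K marg])
  have "transport_dist (mean_dist n d) (pmf_on ?A p) (\<Pi>\<^sub>M i\<in>{1..n}. pmf_on (K i) (map_pmf (\<lambda>w. w i) p))
      \<le> measure_pmf.expectation q (\<lambda>z. mean_dist n d (fst z) (snd z))"
    unfolding product
    by (rule transport_dist_le[OF A q q1' refl])
      (auto simp: mean_dist_def intro!: divide_nonneg_nonneg sum_nonneg d0)
  also have "\<dots> \<le> measure_pmf.expectation q (\<lambda>z. 1 / real n * (\<Sum>i=1..n. indicator {z. fst z i \<noteq> snd z i} z))"
  proof (intro integral_mono_AE AE_pmfI)
    fix z assume z: "z \<in> set_pmf q"
    have "d i (fst z i) (snd z i) \<le> indicator {z. fst z i \<noteq> snd z i} z" if i: "i \<in> {1..n}" for i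
    proof -
      have zi: "fst z i \<in> K i" "snd z i \<in> K i" using z q i by (auto simp: PiE_iff)
      show ?thesis
        using diam[OF i zi] Metric_space.zero[OF d[OF i] zi] by (auto split: split_indicator)
    qed
    then show "mean_dist n d (fst z) (snd z) \<le> 1 / real n * (\<Sum>i=1..n. indicator {z. fst z i \<noteq> snd z i} z)"
      unfolding mean_dist_def by (intro mult_left_mono sum_mono) auto
  qed (rule integrable_measure_pmf_finite[OF finq])+
  also have "\<dots> = 1 / real n * (\<Sum>i=1..n. measure_pmf.prob q {z. fst z i \<noteq> snd z i})"
    by (simp add: Bochner_Integration.integral_sum integrable_measure_pmf_finite[OF finq])
  also have "\<dots> \<le> 1 / real n * (\<Sum>i=1..n. dependence (map_pmf (\<lambda>w. (w i, restrict w {1..<i})) p))"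
    by (intro mult_left_mono sum_mono q3) auto
  finally show ?thesis .
qed

section \<open>The mixture\<close>

theorem theorem8p7:
  fixes n k :: nat
    and K :: "nat \<Rightarrow> 'a set"
    and d :: "nat \<Rightarrow> 'a \<Rightarrow> 'a \<Rightarrow> real"
    and \<delta> :: real
    and \<mu> :: "(nat \<Rightarrow> 'a) measure"
  assumes "n \<ge> 1" and "k \<ge> 1"
    and "\<And>i. i \<in> {1..n} \<Longrightarrow> Metric_space (K i) (d i)"
    and "\<And>i. i \<in> {1..n} \<Longrightarrow> finite (K i)"
    and "\<And>i x y. i \<in> {1..n} \<Longrightarrow> x \<in> K i \<Longrightarrow> y \<in> K i \<Longrightarrow> d i x y \<le> 1"
    and "\<And>i. i \<in> {1..n} \<Longrightarrow> card (K i) \<le> k"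
    and "\<delta> > 0"
    and "\<mu> \<in> space (prob_algebra (prod_space n K))"
  shows "\<exists>(m :: nat) (p :: nat \<Rightarrow> real) (\<mu>s :: nat \<Rightarrow> (nat \<Rightarrow> 'a) measure)
            (\<xi> :: nat \<Rightarrow> (nat \<Rightarrow> 'a) measure).
           (\<forall>j\<in>{1..m}. 0 \<le> p j) \<and> (\<Sum>j=1..m. p j) = 1 \<and>
           (\<forall>j\<in>{1..m}. \<mu>s j \<in> space (prob_algebra (prod_space n K))) \<and>
           (\<forall>A\<in>sets (prod_space n K). measure \<mu> A = (\<Sum>j=1..m. p j * measure (\<mu>s j) A)) \<and>
           real m \<le> real k powr (DTC {1..n} \<mu> / \<delta>\<^sup>2) \<and>
           (\<forall>j\<in>{1..m}. \<xi> j \<in> product_measures n K) \<and>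
           (\<Sum>j=1..m. p j * transport_dist (mean_dist n d) (\<mu>s j) (\<xi> j)) < \<delta>"
proof -
  note n = assms(1) and k = assms(2) and d = assms(3) and K = assms(4) and diam = assms(5)
    and card_K = assms(6) and \<delta> = assms(7) and \<mu> = assms(8)
  let ?I = "{1..n}" and ?\<Omega> = "PiE {1..n} K"
  have sets_prod: "sets (prod_space n K) = Pow ?\<Omega>"
    by (rule sets_PiM_Pow) (auto simp: K)
  have \<Omega>: "finite ?\<Omega>" using K by (intro finite_PiE) auto
  have "sets \<mu> = Pow ?\<Omega>" "prob_space \<mu>"
    using \<mu> unfolding space_prob_algebra sets_prod by auto
  then obtain p where p: "set_pmf p \<subseteq> ?\<Omega>" and \<mu>_eq: "\<mu> = pmf_on ?\<Omega> p"
    using ex_pmf_on[OF \<Omega>] by blast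
  have fin: "finite (set_pmf p)" using \<Omega> p finite_subset by blast
  obtain S where S: "S \<subseteq> ?I"
    and card_S: "\<delta>\<^sup>2 * card S \<le> coord_entropy p ?I - sum (coord_entropy_given_rest p ?I) ?I"
    and small: "\<And>i. i \<in> ?I \<Longrightarrow>
      (\<Sum>z\<in>(\<lambda>w. restrict w S) ` set_pmf p. pmf (map_pmf (\<lambda>w. restrict w S) p) z *
         dependence (map_pmf (\<lambda>w. (w i, restrict w {1..<i})) (fibre_pmf p (\<lambda>w. restrict w S) z))) < \<delta>"
    using exists_conditioning_set_small_dependence[OF fin \<delta>, of n] by blast
  let ?s = "\<lambda>w. restrict w S"
  let ?Z = "?s ` set_pmf p" and ?\<pi> = "pmf (map_pmf ?s p)" and ?\<nu> = "fibre_pmf p ?s"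
  have Z: "finite ?Z" using fin by simp
  have fibre: "set_pmf (?\<nu> z) \<subseteq> ?\<Omega>" if "z \<in> ?Z" for z
    using set_fibre_pmf[OF that] p by blast
  \<comment> \<open>The terms of the mixture are the fibres over the values of \<open>X\<^sub>S\<close> that are attained with
    positive probability; \<open>g\<close> numbers these values.\<close>
  define m where "m = card ?Z"
  obtain g where g: "bij_betw g {1..m} ?Z"
    using ex_bij_betw_nat_finite_1[OF Z] unfolding m_def by blast
  have gZ: "g j \<in> ?Z" if "j \<in> {1..m}" for j
    using g that by (rule bij_betw_apply)
  have reindex: "(\<Sum>j=1..m. F (g j)) = sum F ?Z" for F :: "_ \<Rightarrow> real"
    by (rule sum.reindex_bij_betw[OF g])
  define \<xi> where "\<xi> z = (\<Pi>\<^sub>M i\<in>?I. pmf_on (K i) (map_pmf (\<lambda>w. w i) (?\<nu> z)))" for z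
  have weights: "(\<Sum>j=1..m. ?\<pi> (g j)) = 1"
    unfolding reindex using Z by (intro sum_pmf_eq_1) auto
  have components: "pmf_on ?\<Omega> (?\<nu> (g j)) \<in> space (prob_algebra (prod_space n K))" if "j \<in> {1..m}" for j
    unfolding space_prob_algebra sets_prod using prob_space_pmf_on[OF fibre[OF gZ[OF that]]] by simp
  have mixture: "measure \<mu> A = (\<Sum>j=1..m. ?\<pi> (g j) * measure (pmf_on ?\<Omega> (?\<nu> (g j))) A)"
    if "A \<in> sets (prod_space n K)" for A
  proof -
    have A: "A \<subseteq> ?\<Omega>" using that sets_prod by simp
    have "measure \<mu> A = measure_pmf.prob (bind_pmf (map_pmf ?s p) ?\<nu>) A"
      unfolding bind_fibre_pmf \<mu>_eq by (rule measure_pmf_on[OF A])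
    also have "\<dots> = (\<Sum>z\<in>?Z. ?\<pi> z * measure_pmf.prob (?\<nu> z) A)"
      using fibre \<Omega> by (intro prob_bind_pmf_finite[OF Z]) (auto intro: finite_subset)
    also have "\<dots> = (\<Sum>z\<in>?Z. ?\<pi> z * measure (pmf_on ?\<Omega> (?\<nu> z)) A)"
      using A by (simp add: measure_pmf_on)
    finally show ?thesis
      using reindex[of "\<lambda>z. ?\<pi> z * measure (pmf_on ?\<Omega> (?\<nu> z)) A"] by simp
  qed
  have products: "\<xi> (g j) \<in> product_measures n K" if "j \<in> {1..m}" for j
  proof -
    have "pmf_on (K i) (map_pmf (\<lambda>w. w i) (?\<nu> (g j))) \<in> space (prob_algebra (count_space (K i)))"
      if i: "i \<in> ?I" for i
    proof -
      have "set_pmf (map_pmf (\<lambda>w. w i) (?\<nu> (g j))) \<subseteq> K i"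
        using fibre[OF gZ[OF \<open>j \<in> {1..m}\<close>]] i by (auto simp: PiE_iff subset_eq)
      then show ?thesis by (simp add: space_prob_algebra prob_space_pmf_on)
    qed
    then show ?thesis unfolding product_measures_def \<xi>_def by blast
  qed
  have "real m \<le> real k powr (DTC ?I \<mu> / \<delta>\<^sup>2)"
  proof -
    have fS: "finite S" using S finite_subset by blast
    have "?Z \<subseteq> PiE S K" using p S by (auto simp: PiE_iff subset_eq)
    then have "m \<le> card (PiE S K)"
      unfolding m_def using K S fS by (intro card_mono finite_PiE) auto
    also have "\<dots> = (\<Prod>i\<in>S. card (K i))" by (rule card_PiE[OF fS])
    also have "\<dots> \<le> (\<Prod>i\<in>S. k)" using card_K S by (intro prod_mono) auto
    finally have "real m \<le> real k ^ card S"
      unfolding prod_constant of_nat_power[symmetric] of_nat_le_iff .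
    also have "\<dots> = real k powr card S" using k by (simp add: powr_realpow)
    also have "\<dots> \<le> real k powr (DTC ?I \<mu> / \<delta>\<^sup>2)"
    proof (rule powr_mono)
      have "\<delta>\<^sup>2 * card S \<le> DTC ?I \<mu>"
        unfolding \<mu>_eq using card_S DTC_pmf_on[OF finite_atLeastAtMost K p] by simp
      then show "card S \<le> DTC ?I \<mu> / \<delta>\<^sup>2" using \<delta> by (simp add: field_simps)
    qed (use k in simp)
    finally show ?thesis .
  qed
  moreover have "(\<Sum>j=1..m. ?\<pi> (g j) * transport_dist (mean_dist n d) (pmf_on ?\<Omega> (?\<nu> (g j))) (\<xi> (g j))) < \<delta>"
  proof -
    let ?t = "\<lambda>i z. dependence (map_pmf (\<lambda>w. (w i, restrict w {1..<i})) (?\<nu> z))"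
    have "(\<Sum>j=1..m. ?\<pi> (g j) * transport_dist (mean_dist n d) (pmf_on ?\<Omega> (?\<nu> (g j))) (\<xi> (g j)))
      = (\<Sum>z\<in>?Z. ?\<pi> z * transport_dist (mean_dist n d) (pmf_on ?\<Omega> (?\<nu> z)) (\<xi> z))"
      by (rule reindex)
    also have "\<dots> \<le> (\<Sum>z\<in>?Z. ?\<pi> z * (1 / real n * (\<Sum>i=1..n. ?t i z)))"
      unfolding \<xi>_def
      by (intro sum_mono mult_left_mono transport_dist_product_le_dependence d K diam fibre) auto
    also have "\<dots> = 1 / real n * (\<Sum>i=1..n. \<Sum>z\<in>?Z. ?\<pi> z * ?t i z)"
      by (subst sum.swap) (simp add: sum_distrib_left mult.left_commute)
    also have "\<dots> < 1 / real n * (\<Sum>i=1..n. \<delta>)"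
      using n by (intro mult_strict_left_mono sum_strict_mono small) auto
    also have "\<dots> = \<delta>" using n by simp
    finally show ?thesis .
  qed
  ultimately show ?thesis
    using weights components mixture products
    by (intro exI[of _ m] exI[of _ "\<lambda>j. ?\<pi> (g j)"] exI[of _ "\<lambda>j. pmf_on ?\<Omega> (?\<nu> (g j))"]
        exI[of _ "\<lambda>j. \<xi> (g j)"]) simp
qed

end
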